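(* Let $N,n$ be integers with $N\geq n\geq 13$. Then $$ex(N,\mathcal{F}_n^{(3)})=t_3(N,n-1).$$ Furthermore, the unique (up to isomorphism) extremal hypergraph on $N$ vertices for $\mathcal{F}_n^{(3)}$ is $T_3(N,n-1)$; that is, every $\mathcal{F}_n^{(3)}$-free $3$-uniform hypergraph on $N$ vertices with exactly $ex(N,\mathcal{F}_n^{(3)})$ edges is isomorphic to $T_3(N,n-1)$.
   Context: A hypergraph is a pair $\mathcal{H}=(V,E)$ with $V$ a finite non-empty set of vertices and $E$ a collection of distinct non-empty subsets of $V$ (edges; no repeated edges). It is $3$-uniform (a $3$-graph) if all edges have size $3$. Complete $3$-uniform Berge-hypergraph: for $n\ge 5$, a complete $3$-uniform Berge-hypergraph of order $n$, denoted $K_n^{(3)}$, is a $3$-uniform hypergraph consisting of a core sequence of $n$ distinct vertices $v_1,\dots,v_n$ and $\binom{n}{2}$ pairwise distinct edges $e_{ij}$, $1\le i<j\le n$, such that $\{v_i,v_j\}\subseteq e_{ij}$ for all $i<j$. There is no constraint on the remaining vertices of the edges $e_{ij}$: each may lie inside or outside the core, and edges may intersect arbitrarily outside the core. $\mathcal{F}_n^{(3)}$ denotes the family of all complete $3$-uniform Berge-hypergraphs of order $n$. A $3$-graph is $\mathcal{F}_n^{(3)}$-free if it contains no member of $\mathcal{F}_n^{(3)}$ as a (not necessarily induced) subgraph. The Turán number $ex(N,\mathcal{F}_n^{(3)})$ is the maximum number of edges of an $\mathcal{F}_n^{(3)}$-free $3$-graph on $N$ vertices. An extremal hypergraph on $N$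 vertices for $\mathcal{F}_n^{(3)}$ is an $\mathcal{F}_n^{(3)}$-free $3$-graph on $N$ vertices with exactly $ex(N,\mathcal{F}_n^{(3)})$ edges. $T_3(N,n-1)$ is the complete $3$-uniform $(n-1)$-partite hypergraph on $N$ vertices whose parts $V_1,\dots,V_{n-1}$ differ in size by at most $1$: its edges are all $3$-subsets of vertices containing at most one vertex from each part. $t_3(N,n-1)$ is the number of edges of $T_3(N,n-1)$; if $N=\ell(n-1)+j$ with $\ell\ge 1$ and $1\le j\le n-1$, then $t_3(N,n-1)=\sum_{i=0}^{3}\ell^{3-i}\binom{j}{i}\binom{n-1-i}{3-i}$. *)

theory Defs
  imports Main
begin

type_synonym 'a hypergraph = "'a set \<times> 'a set set"

abbreviation verts :: "'a hypergraph \<Rightarrow> 'a set" where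
  "verts \<equiv> fst"

abbreviation edges :: "'a hypergraph \<Rightarrow> 'a set set" where
  "edges \<equiv> snd"

definition hypergraph :: "'a hypergraph \<Rightarrow> bool" where
  "hypergraph H \<longleftrightarrow>
     finite (verts H) \<and> verts H \<noteq> {} \<and> edges H \<subseteq> Pow (verts H) \<and> {} \<notin> edges H"

definition three_graph :: "'a hypergraph \<Rightarrow> bool" where
  "three_graph H \<longleftrightarrow> hypergraph H \<and> (\<forall>e\<in>edges H. card e = 3)"

definition subhypergraph :: "'a hypergraph \<Rightarrow> 'a hypergraph \<Rightarrow> bool" where
  "subhypergraph G H \<longleftrightarrow>
     hypergraph G \<and> hypergraph H \<and> verts G \<subseteq> verts H \<and> edges G \<subseteq> edges H"

definition hyper_iso :: "'a hypergraph \<Rightarrow> 'b hypergraph \<Rightarrow> bool" where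
  "hyper_iso G H \<longleftrightarrow>
     (\<exists>f. bij_betw f (verts G) (verts H) \<and> (\<lambda>e. f ` e) ` edges G = edges H)"

definition index_pairs :: "nat \<Rightarrow> (nat \<times> nat) set" where
  "index_pairs n = {(i, j). 1 \<le> i \<and> i < j \<and> j \<le> n}"

text \<open>
  The family of complete 3-uniform Berge-hypergraphs of order \<open>n\<close>: \<open>v\<close> is the core sequence and
  \<open>e (i, j)\<close> is the edge chosen for the pair \<open>i < j\<close>. Such a hypergraph has no other edges and no
  vertices besides the core and those lying on edges. The family is closed under isomorphism
  within a vertex type, so that containing a member can be expressed by \<open>subhypergraph\<close>.
\<close>

definition berge3 :: "nat \<Rightarrow> 'a hypergraph set" where
  "berge3 n = {K. three_graph K \<and>
     (\<exists>(v :: nat \<Rightarrow> 'a) (e :: nat \<times> nat \<Rightarrow> 'a set).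
        inj_on v {1..n} \<and> inj_on e (index_pairs n) \<and>
        (\<forall>(i, j)\<in>index_pairs n. {v i, v j} \<subseteq> e (i, j)) \<and>
        edges K = e ` index_pairs n \<and>
        verts K = v ` {1..n} \<union> \<Union>(edges K))}"

definition family_free :: "'a hypergraph set \<Rightarrow> 'a hypergraph \<Rightarrow> bool" where
  "family_free F H \<longleftrightarrow> \<not> (\<exists>K\<in>F. subhypergraph K H)"

text \<open>
  The maximum ranges over 3-graphs whose vertices are natural numbers; every finite hypergraph,
  over any vertex type, is isomorphic to one of these.
\<close>

definition turan_number :: "nat \<Rightarrow> nat hypergraph set \<Rightarrow> nat" where
  "turan_number N F =
     Max {card (edges H) | H. three_graph H \<and> card (verts H) = N \<and> family_free F H}"

text \<open>
  Extremal hypergraphs may live on any vertex type, whereas the Turan number is always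
  the one computed over the natural numbers.
\<close>

definition extremal_berge3 :: "nat \<Rightarrow> nat \<Rightarrow> 'a hypergraph \<Rightarrow> bool" where
  "extremal_berge3 N n H \<longleftrightarrow>
     three_graph H \<and> card (verts H) = N \<and> family_free (berge3 n) H \<and>
     card (edges H) = turan_number N (berge3 n)"

definition complete_partite3 :: "'i set \<Rightarrow> ('i \<Rightarrow> 'a set) \<Rightarrow> 'a hypergraph" where
  "complete_partite3 I P =
     (\<Union>i\<in>I. P i,
      {e. e \<subseteq> (\<Union>i\<in>I. P i) \<and> card e = 3 \<and> (\<forall>i\<in>I. card (e \<inter> P i) \<le> 1)})"

definition residue_part :: "nat \<Rightarrow> nat \<Rightarrow> nat \<Rightarrow> nat set" where
  "residue_part N k r = {x. x < N \<and> x mod k = r}"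

text \<open>
  The balanced complete \<open>k\<close>-partite 3-graph on \<open>N\<close> vertices, represented on \<open>{..<N}\<close> with the
  residue classes modulo \<open>k\<close> as parts. The lemmas below confirm that these form a partition
  into \<open>k\<close> parts whose sizes differ by at most one.
\<close>

definition T3 :: "nat \<Rightarrow> nat \<Rightarrow> nat hypergraph" where
  "T3 N k = complete_partite3 {..<k} (residue_part N k)"

definition t3 :: "nat \<Rightarrow> nat \<Rightarrow> nat" where
  "t3 N k = card (edges (T3 N k))"

lemma residue_part_Union: "k > 0 \<Longrightarrow> (\<Union>r\<in>{..<k}. residue_part N k r) = {..<N}"
  by (auto simp: residue_part_def)

lemma residue_part_disjoint: "r \<noteq> s \<Longrightarrow> residue_part N k r \<inter> residue_part N k s = {}"
  by (auto simp: residue_part_def)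

lemma residue_part_card:
  assumes "r < k"
  shows "card (residue_part N k r) \<in> {N div k, N div k + 1}"
proof -
  let ?Q = "{q. r + k * q < N}"
  have k: "k > 0" using assms by simp
  have eq: "residue_part N k r = (\<lambda>q. r + k * q) ` ?Q"
  proof (intro equalityI subsetI)
    fix x assume x: "x \<in> residue_part N k r"
    then have "x = r + k * (x div k)"
      by (metis (mono_tags, lifting) mem_Collect_eq mod_mult_div_eq residue_part_def)
    with x show "x \<in> (\<lambda>q. r + k * q) ` ?Q" by (auto simp: residue_part_def)
  qed (use assms in \<open>auto simp: residue_part_def\<close>)
  have "inj_on (\<lambda>q. r + k * q) ?Q" using k by (auto simp: inj_on_def)
  then have card: "card (residue_part N k r) = card ?Q" by (simp add: eq card_image)
  have "q \<le> N div k" if "r + k * q < N" for q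
  proof -
    have "q * k \<le> N" using that by (simp add: mult.commute)
    then show ?thesis using k by (simp add: less_eq_div_iff_mult_less_eq)
  qed
  then have up: "?Q \<subseteq> {..N div k}" by auto
  have "r + k * q < N" if "q < N div k" for q
  proof -
    have "Suc q * k \<le> N" using that k by (metis Suc_leI less_eq_div_iff_mult_less_eq)
    then show ?thesis using assms by (simp add: mult.commute)
  qed
  then have lo: "{..<N div k} \<subseteq> ?Q" by auto
  have "card ?Q \<le> Suc (N div k)" using card_mono[OF _ up] by simp
  moreover have "N div k \<le> card ?Q" using card_mono[OF finite_subset[OF up] lo] by simp
  ultimately show ?thesis using card by auto
qed

text \<open>The maximum in \<open>turan_number\<close> is taken over a finite non-empty set.\<close>

lemma turan_set_finite:
  "finite {card (edges H) | H :: nat hypergraph.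
     three_graph H \<and> card (verts H) = N \<and> family_free F H}"
proof (rule finite_subset)
  show "{card (edges H) | H :: nat hypergraph.
     three_graph H \<and> card (verts H) = N \<and> family_free F H} \<subseteq> {..2 ^ N}"
  proof
    fix m assume "m \<in> {card (edges H) | H :: nat hypergraph.
      three_graph H \<and> card (verts H) = N \<and> family_free F H}"
    then obtain H :: "nat hypergraph"
      where H: "three_graph H" "card (verts H) = N" "m = card (edges H)" by blast
    then have "finite (verts H)" "edges H \<subseteq> Pow (verts H)"
      by (auto simp: three_graph_def hypergraph_def)
    then have "card (edges H) \<le> card (Pow (verts H))" by (intro card_mono) auto
    then show "m \<in> {..2 ^ N}"
      using \<open>finite (verts H)\<close> H by (simp add: card_Pow)
  qed
qed simp

lemma turan_set_nonempty:
  assumes "N > 0" "n \<ge> 2"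
  shows "{card (edges H) | H :: nat hypergraph.
     three_graph H \<and> card (verts H) = N \<and> family_free (berge3 n) H} \<noteq> {}"
proof -
  let ?H = "({..<N}, {}) :: nat hypergraph"
  have "three_graph ?H" using assms by (auto simp: three_graph_def hypergraph_def)
  moreover have "(1, 2) \<in> index_pairs n" using assms by (simp add: index_pairs_def)
  then have "family_free (berge3 n) ?H"
    by (auto simp: family_free_def berge3_def subhypergraph_def)
  moreover have "card (verts ?H) = N" by simp
  ultimately show ?thesis by blast
qed

end

theory Submission
  imports Defs
begin

text \<open>
  Choosing a set \<open>S\<close> of edges of \<open>H\<close> of maximal deficiency \<open>card S\<close> minus the number of pairs
  covered by \<open>S\<close>, Hall's theorem assigns distinct edges of \<open>S\<close> to all pairs covered by \<open>S\<close> (coloured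
  blue) and distinct uncovered pairs to all other edges (coloured red). The coloured graph is
  \<open>K\<^sub>n\<close>-free because every coloured pair owns an edge of \<open>H\<close>, and \<open>H\<close> has at most as many edges as
  there are red pairs plus blue triangles (the red-blue method of Gerbner, Methuku and Palmer).

  This last quantity is maximised over \<open>K\<^sub>n\<close>-free coloured graphs by Zykov symmetrization. In an
  optimal graph non-adjacency is transitive: otherwise, comparison with a cloned vertex exhibits an
  adjacent pair that contributes nothing, and colouring it red is a gain. Hence the graph is complete
  multipartite, with exactly \<open>n - 1\<close> parts, since with fewer parts one more red pair could be
  added. Each red pair lies in at least \<open>n - 3 > 3\<close> triangles, so recolouring everything
  blue is a strict gain unless there is no red pair; finally, moving a vertex from a large part to a
  small one shows that the parts are balanced. In the case of equality no pair is red, so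
  the edges of \<open>H\<close> are exactly the triangles of the Turan graph.
\<close>

section \<open>Hall's theorem\<close>

text \<open>Induction on \<open>card I\<close>. If a nonempty proper subset \<open>J\<close> is
  tight, match \<open>J\<close> inside its own neighbourhood and the other indices outside it. If
  none is tight, every nonempty proper subset has an element to spare, so an arbitrary value can be
  fixed for one index and withdrawn from the others.\<close>

theorem hall:
  fixes A :: "'i \<Rightarrow> 'b set"
  assumes "finite I" and "\<And>i. i \<in> I \<Longrightarrow> finite (A i)"
    and "\<And>J. J \<subseteq> I \<Longrightarrow> card J \<le> card (\<Union>(A ` J))"
  shows "\<exists>f. inj_on f I \<and> (\<forall>i\<in>I. f i \<in> A i)"
  using assms
proof (induction "card I" arbitrary: I A rule: less_induct)
  case less
  note fin = less.prems(2) and hall = less.prems(3)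
  show ?case
  proof (cases "I = {}")
    case False
    show ?thesis
    proof (cases "\<exists>J. J \<noteq> {} \<and> J \<subset> I \<and> card (\<Union>(A ` J)) = card J")
      case True
      then obtain J where J: "J \<noteq> {}" "J \<subset> I" and tight: "card (\<Union>(A ` J)) = card J"
        by blast
      let ?U = "\<Union>(A ` J)"
      have finJ: "finite J" using J less.prems(1) finite_subset by blast
      have finU: "finite ?U" using finJ J fin by blast
      have "card J < card I" using J less.prems(1) psubset_card_mono by blast
      then have "\<exists>f. inj_on f J \<and> (\<forall>i\<in>J. f i \<in> A i)"
      proof (rule less.hyps)
        show "finite (A i)" if "i \<in> J" for i using that J fin by blast
        show "card L \<le> card (\<Union>(A ` L))" if "L \<subseteq> J" for L using that J by (intro hall) auto
      qed (fact finJ)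
      then obtain f where f: "inj_on f J" "\<forall>i\<in>J. f i \<in> A i" by blast
      let ?B = "\<lambda>i. A i - ?U"
      have "card (I - J) < card I"
        using J less.prems(1) by (intro psubset_card_mono) auto
      moreover have "card L \<le> card (\<Union>(?B ` L))" if L: "L \<subseteq> I - J" for L
      proof -
        have finL: "finite L" using L less.prems(1) finite_subset by blast
        \<comment> \<open>The Hall condition for \<open>L \<union> J\<close>, minus the tight
          equality for \<open>J\<close>, is the condition for \<open>L\<close> outside
          \<open>?U\<close>.\<close>
        have "card L + card J = card (L \<union> J)"
          using L finL finJ by (subst card_Un_disjoint) auto
        also have "\<dots> \<le> card (\<Union>(A ` (L \<union> J)))" using L J by (intro hall) auto
        also have "\<Union>(A ` (L \<union> J)) = \<Union>(?B ` L) \<union> ?U" by auto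
        also have "card \<dots> \<le> card (\<Union>(?B ` L)) + card ?U" by (rule card_Un_le)
        finally show ?thesis using tight by simp
      qed
      ultimately have "\<exists>g. inj_on g (I - J) \<and> (\<forall>i\<in>I - J. g i \<in> ?B i)"
        using less.hyps[of "I - J" ?B] less.prems(1) fin by auto
      then obtain g where g: "inj_on g (I - J)" "\<forall>i\<in>I - J. g i \<in> ?B i" by blast
      let ?h = "\<lambda>i. if i \<in> J then f i else g i"
      have "inj_on ?h I"
      proof (rule inj_onI)
        fix x y assume xy: "x \<in> I" "y \<in> I" "?h x = ?h y"
        have sep: "f a \<noteq> g b" if "a \<in> J" "b \<in> I - J" for a b
          using bspec[OF f(2) that(1)] bspec[OF g(2) that(2)] that(1) by auto
        show "x = y"
          using xy f(1) g(1) sep[of x y] sep[of y x]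
          by (cases "x \<in> J"; cases "y \<in> J") (auto dest: inj_onD)
      qed
      moreover have "\<forall>i\<in>I. ?h i \<in> A i" using f g by auto
      ultimately show ?thesis by blast
    next
      case slack: False
      obtain i where i: "i \<in> I" using False by blast
      have "card {i} \<le> card (\<Union>(A ` {i}))" using i by (intro hall) auto
      then obtain a where a: "a \<in> A i" by fastforce
      let ?B = "\<lambda>j. A j - {a}"
      have "card (I - {i}) < card I" using i less.prems(1) by (rule card_Diff1_less[rotated])
      moreover have "card L \<le> card (\<Union>(?B ` L))" if L: "L \<subseteq> I - {i}" for L
      proof (cases "L = {}")
        case False
        have finU: "finite (\<Union>(A ` L))" using L less.prems(1) fin
          by (intro finite_UN_I) (auto intro: finite_subset)
        have "L \<subset> I" using L i by blast
        \<comment> \<open>Strictness in the Hall condition for \<open>L\<close> pays for the loss of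
          the single element \<open>a\<close>.\<close>
        then have "card (\<Union>(A ` L)) \<noteq> card L" using slack False by blast
        then have "card L < card (\<Union>(A ` L))"
          using hall[of L] \<open>L \<subset> I\<close> by (simp add: psubset_eq)
        moreover have "\<Union>(?B ` L) = \<Union>(A ` L) - {a}" by auto
        ultimately show ?thesis
          using diff_card_le_card_Diff[of "{a}" "\<Union>(A ` L)"] by simp
      qed simp
      ultimately have "\<exists>g. inj_on g (I - {i}) \<and> (\<forall>j\<in>I - {i}. g j \<in> ?B j)"
        using less.hyps[of "I - {i}" ?B] less.prems(1) fin by auto
      then obtain g where g: "inj_on g (I - {i})" "\<forall>j\<in>I - {i}. g j \<in> ?B j" by blast
      have "inj_on (g(i := a)) I"
        using g by (auto simp: inj_on_def)
      moreover have "\<forall>j\<in>I. (g(i := a)) j \<in> A j" using g a by auto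
      ultimately show ?thesis by blast
    qed
  qed simp
qed

section \<open>Edge-coloured graphs\<close>

datatype link = Absent | Red | Blue

text \<open>The diagonal is \<open>Absent\<close> so that non-adjacency is reflexive and can become
  an equivalence relation.\<close>

definition coloring :: "('a \<Rightarrow> 'a \<Rightarrow> link) \<Rightarrow> bool" where
  "coloring c \<longleftrightarrow> (\<forall>x y. c x y = c y x) \<and> (\<forall>x. c x x = Absent)"

definition clique_free :: "nat \<Rightarrow> 'a set \<Rightarrow> ('a \<Rightarrow> 'a \<Rightarrow> link) \<Rightarrow> bool" where
  "clique_free n V c \<longleftrightarrow> (\<forall>S\<subseteq>V. pairwise (\<lambda>x y. c x y \<noteq> Absent) S \<longrightarrow> card S < n)"

text \<open>
  Red edges and blue triangles are kept in one family of sets: its cardinality is the quantity to be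
  maximised, and cloning a vertex acts uniformly on its members.
\<close>

definition red_blue :: "'a set \<Rightarrow> ('a \<Rightarrow> 'a \<Rightarrow> link) \<Rightarrow> 'a set set" where
  "red_blue V c = {e. e \<subseteq> V \<and>
     (card e = 2 \<and> pairwise (\<lambda>x y. c x y = Red) e \<or>
      card e = 3 \<and> pairwise (\<lambda>x y. c x y = Blue) e)}"

definition optimal :: "nat \<Rightarrow> 'a set \<Rightarrow> ('a \<Rightarrow> 'a \<Rightarrow> link) \<Rightarrow> bool" where
  "optimal n V c \<longleftrightarrow> coloring c \<and> clique_free n V c \<and>
     (\<forall>c'. coloring c' \<longrightarrow> clique_free n V c' \<longrightarrow> card (red_blue V c') \<le> card (red_blue V c))"

lemma coloring_sym: "coloring c \<Longrightarrow> c x y = c y x"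
  by (simp add: coloring_def)

lemma coloring_refl [simp]: "coloring c \<Longrightarrow> c x x = Absent"
  by (simp add: coloring_def)

lemma finite_red_blue [simp]: "finite V \<Longrightarrow> finite (red_blue V c)"
  by (rule finite_subset[of _ "Pow V"]) (auto simp: red_blue_def)

lemma red_blue_linked:
  "e \<in> red_blue V c \<Longrightarrow> x \<in> e \<Longrightarrow> y \<in> e \<Longrightarrow> x \<noteq> y \<Longrightarrow> c x y \<noteq> Absent"
  by (auto simp: red_blue_def pairwise_def)

lemma red_blue_red:
  assumes "coloring c" "x \<in> V" "y \<in> V" "c x y = Red"
  shows "{x, y} \<in> red_blue V c"
  using assms coloring_sym[of c x y]
  by (cases "x = y") (auto simp: red_blue_def pairwise_def)

text \<open>The all-\<open>Absent\<close> colouring is admissible, as its cliques have at most one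
  vertex and \<open>n \<ge> 2\<close>; the counts are bounded by \<open>card (Pow V)\<close>, so a
  maximum is attained.\<close>

lemma optimal_exists:
  assumes "finite V" "n \<ge> 2"
  shows "\<exists>c. optimal n V c"
proof -
  let ?P = "\<lambda>c. coloring c \<and> clique_free n V c"
  have "card S < n" if "S \<subseteq> V" "pairwise (\<lambda>x y. False) S" for S :: "'a set"
  proof -
    have "card S \<le> Suc 0" using that assms(1) by (auto simp: pairwise_def card_le_Suc0_iff_eq finite_subset)
    then show ?thesis using assms by simp
  qed
  then have "?P (\<lambda>_ _. Absent)"
    by (auto simp: coloring_def clique_free_def)
  moreover have "card (red_blue V c) \<le> card (Pow V)" for c
    using assms by (intro card_mono) (auto simp: red_blue_def)
  ultimately have "\<exists>c. ?P c \<and> (\<forall>c'. ?P c' \<longrightarrow> card (red_blue V c') \<le> card (red_blue V c))"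
    by (intro ex_has_greatest_nat[where b = "Suc (card (Pow V))"]) (auto simp: less_Suc_eq_le)
  then show ?thesis by (auto simp: optimal_def)
qed

section \<open>Zykov symmetrization: turning \<open>u\<close> into a twin of
  \<open>v\<close>\<close>

definition clone :: "'a \<Rightarrow> 'a \<Rightarrow> ('a \<Rightarrow> 'a \<Rightarrow> link) \<Rightarrow> 'a \<Rightarrow> 'a \<Rightarrow> link" where
  "clone u v c x y = c (if x = u then v else x) (if y = u then v else y)"

lemma coloring_clone [simp]: "coloring c \<Longrightarrow> coloring (clone u v c)"
  by (auto simp: coloring_def clone_def)

text \<open>A clique of the new graph cannot contain both twins, as their link is
  \<open>c v v = Absent\<close>. Replacing \<open>u\<close> by \<open>v\<close> therefore maps it
  injectively onto a clique of \<open>c\<close>.\<close>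

lemma clique_free_clone:
  assumes "clique_free n V c" "coloring c" "v \<in> V"
  shows "clique_free n V (clone u v c)"
  unfolding clique_free_def
proof (intro allI impI)
  fix S assume S: "S \<subseteq> V" "pairwise (\<lambda>x y. clone u v c x y \<noteq> Absent) S"
  let ?f = "\<lambda>x. if x = u then v else x"
  have "inj_on ?f S"
    using S(2) assms(2) by (force simp: inj_on_def pairwise_def clone_def)
  moreover have "pairwise (\<lambda>x y. c x y \<noteq> Absent) (?f ` S)"
    unfolding pairwise_image using S(2) by (auto simp: pairwise_def clone_def)
  moreover have "?f ` S \<subseteq> V" using S(1) assms(3) by auto
  ultimately have "card (?f ` S) < n"
    using assms(1) by (simp add: clique_free_def)
  then show "card S < n" using card_image[OF \<open>inj_on ?f S\<close>] by argo
qed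

text \<open>Members through \<open>u\<close> are lost, members avoiding \<open>u\<close> survive,
  and each survivor through \<open>v\<close> acquires a copy with \<open>u\<close> in place of
  \<open>v\<close>.\<close>

lemma red_blue_clone:
  assumes "coloring c" "u \<in> V" "v \<in> V" "u \<noteq> v"
  shows "red_blue V (clone u v c) = {e \<in> red_blue V c. u \<notin> e} \<union>
    (\<lambda>e. insert u (e - {v})) ` {e \<in> red_blue V c. v \<in> e \<and> u \<notin> e}" (is "?L = ?A \<union> ?B")
proof (intro equalityI subsetI)
  fix e assume e: "e \<in> ?L"
  show "e \<in> ?A \<union> ?B"
  proof (cases "u \<in> e")
    case False
    then have "e \<in> ?A" using e by (auto simp: red_blue_def pairwise_def clone_def split: if_splits)
    then show ?thesis by simp
  next
    case True
    have "clone u v c u v = Absent" using assms by (simp add: clone_def)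
    then have v: "v \<notin> e" using red_blue_linked[OF e True] assms by blast
    let ?e = "insert v (e - {u})"
    have "finite e" using e by (auto simp: red_blue_def intro: card_ge_0_finite)
    then have "card ?e = card e" using True v by (simp add: card_Suc_Diff1 del: card_Diff_insert card_Diff_singleton)
    then have "?e \<in> red_blue V c" using e True v assms
      by (auto simp: red_blue_def pairwise_def clone_def split: if_splits)
    moreover have "insert u (?e - {v}) = e" using True v by auto
    ultimately show ?thesis using assms(4) by (metis (no_types, lifting) DiffD2 UnCI imageI insertCI insertE mem_Collect_eq)
  qed
next
  fix e assume "e \<in> ?A \<union> ?B"
  then show "e \<in> ?L"
  proof
    assume "e \<in> ?A"
    then show ?thesis by (auto simp: red_blue_def pairwise_def clone_def)
  next
    assume "e \<in> ?B"
    then obtain d where d: "d \<in> red_blue V c" "v \<in> d" "u \<notin> d" "e = insert u (d - {v})" by auto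
    have "finite d" using d by (auto simp: red_blue_def intro: card_ge_0_finite)
    then have "card e = card d" using d by (simp add: card_Suc_Diff1 del: card_Diff_insert card_Diff_singleton)
    then show ?thesis using d assms
      by (auto simp: red_blue_def pairwise_def clone_def)
  qed
qed

text \<open>The balance of losses and gains under cloning, written additively to avoid subtraction
  on naturals.\<close>

lemma card_red_blue_clone:
  assumes "coloring c" "finite V" "u \<in> V" "v \<in> V" "u \<noteq> v"
  shows "card (red_blue V (clone u v c)) + card {e \<in> red_blue V c. u \<in> e} =
    card (red_blue V c) + card {e \<in> red_blue V c. v \<in> e \<and> u \<notin> e}"
proof -
  let ?F = "red_blue V c" and ?g = "\<lambda>e. insert u (e - {v})"
  have "inj_on ?g {e \<in> ?F. v \<in> e \<and> u \<notin> e}"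
  proof (rule inj_onI)
    fix x y assume *: "x \<in> {e \<in> ?F. v \<in> e \<and> u \<notin> e}" "y \<in> {e \<in> ?F. v \<in> e \<and> u \<notin> e}" "?g x = ?g y"
    then have "x - {v} = y - {v}" by (metis (no_types, lifting) DiffD1 insert_ident mem_Collect_eq)
    then show "x = y" using * by auto
  qed
  then have "card (?g ` {e \<in> ?F. v \<in> e \<and> u \<notin> e}) = card {e \<in> ?F. v \<in> e \<and> u \<notin> e}"
    by (rule card_image)
  moreover have "card (red_blue V (clone u v c)) =
      card {e \<in> ?F. u \<notin> e} + card (?g ` {e \<in> ?F. v \<in> e \<and> u \<notin> e})"
    unfolding red_blue_clone[OF assms(1,3,4,5)]
    using assms(2) by (intro card_Un_disjoint) auto
  moreover have "card ?F = card {e \<in> ?F. u \<notin> e} + card {e \<in> ?F. u \<in> e}"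
  proof -
    have "?F = {e \<in> ?F. u \<notin> e} \<union> {e \<in> ?F. u \<in> e}" by blast
    then show ?thesis using assms(2)
      by (metis (no_types, lifting) card_Un_disjoint disjoint_iff finite_Un finite_red_blue mem_Collect_eq)
  qed
  ultimately show ?thesis by simp
qed

text \<open>Otherwise making the vertex of smaller degree a twin of the other one would raise the
  count; being non-adjacent, the two share no member.\<close>

lemma optimal_degree:
  assumes "optimal n V c" "finite V" "u \<in> V" "v \<in> V" "c u v = Absent"
  shows "card {e \<in> red_blue V c. u \<in> e} = card {e \<in> red_blue V c. v \<in> e}"
proof -
  have *: "card {e \<in> red_blue V c. y \<in> e} \<le> card {e \<in> red_blue V c. x \<in> e}"
    if "x \<in> V" "y \<in> V" "c x y = Absent" "x \<noteq> y" for x y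
  proof -
    have "card (red_blue V (clone x y c)) \<le> card (red_blue V c)"
      using assms(1) that by (auto simp: optimal_def clique_free_clone)
    then have "card {e \<in> red_blue V c. y \<in> e \<and> x \<notin> e} \<le> card {e \<in> red_blue V c. x \<in> e}"
      using card_red_blue_clone[of c V x y] assms that by (simp add: optimal_def)
    moreover have "{e \<in> red_blue V c. y \<in> e \<and> x \<notin> e} = {e \<in> red_blue V c. y \<in> e}"
      using red_blue_linked that by fastforce
    ultimately show ?thesis by simp
  qed
  show ?thesis
    using *[of u v] *[of v u] assms coloring_sym[of c u v]
    by (cases "u = v") (auto simp: optimal_def)
qed

definition set_red :: "'a \<Rightarrow> 'a \<Rightarrow> ('a \<Rightarrow> 'a \<Rightarrow> link) \<Rightarrow> 'a \<Rightarrow> 'a \<Rightarrow> link" where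
  "set_red x y c a b = (if {a, b} = {x, y} then Red else c a b)"

text \<open>If no member contained both \<open>x\<close> and \<open>y\<close>, colouring this pair
  red would destroy nothing and add the member \<open>{x, y}\<close>.\<close>

lemma optimal_covers_pair:
  assumes "optimal n V c" "finite V" "x \<in> V" "y \<in> V" "x \<noteq> y"
    and "clique_free n V (set_red x y c)"
  shows "\<exists>e\<in>red_blue V c. x \<in> e \<and> y \<in> e"
proof (rule ccontr)
  assume none: "\<not> ?thesis"
  let ?c = "set_red x y c"
  have c: "coloring c" using assms(1) by (simp add: optimal_def)
  have "coloring ?c" using c assms(5) by (auto simp: coloring_def set_red_def doubleton_eq_iff)
  then have le: "card (red_blue V ?c) \<le> card (red_blue V c)"
    using assms(1,6) by (simp add: optimal_def)
  have xy: "{x, y} \<in> red_blue V ?c"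
    using assms(3,4) \<open>coloring ?c\<close> by (intro red_blue_red) (auto simp: set_red_def)
  have "e \<in> red_blue V ?c" if e: "e \<in> red_blue V c" for e
  proof -
    have "{a, b} \<noteq> {x, y}" if "a \<in> e" "b \<in> e" for a b
      using none e that by (auto simp: doubleton_eq_iff)
    then have "?c a b = c a b" if "a \<in> e" "b \<in> e" for a b
      using that by (simp add: set_red_def)
    then show ?thesis using e by (auto simp: red_blue_def pairwise_def)
  qed
  then have "insert {x, y} (red_blue V c) \<subseteq> red_blue V ?c" using xy by blast
  then have "card (insert {x, y} (red_blue V c)) \<le> card (red_blue V ?c)"
    using assms(2) by (intro card_mono) auto
  moreover have "{x, y} \<notin> red_blue V c" using none by blast
  ultimately show False using le assms(2) by simp
qed

text \<open>Suppose \<open>u\<close> and \<open>w\<close> are adjacent. All three vertices have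
  equal degree, so making \<open>u\<close> a twin of \<open>v\<close> keeps the count and hence
  optimality. Comparing the degrees of \<open>v\<close> and \<open>w\<close> afterwards shows that
  no member contained both \<open>u\<close> and \<open>w\<close>, which contradicts
  \<open>optimal_covers_pair\<close>.\<close>

lemma optimal_absent_trans:
  assumes opt: "optimal n V c" and fin: "finite V" and V: "u \<in> V" "v \<in> V" "w \<in> V"
    and uv: "c u v = Absent" and vw: "c v w = Absent"
  shows "c u w = Absent"
proof (rule ccontr)
  assume uw: "c u w \<noteq> Absent"
  have c: "coloring c" and cf: "clique_free n V c" using opt by (auto simp: optimal_def)
  have ne: "u \<noteq> v" "u \<noteq> w" using uw vw c by auto
  let ?F = "red_blue V c" and ?c = "clone u v c"
  have deg: "card {e \<in> ?F. u \<in> e} = card {e \<in> ?F. v \<in> e}"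
    "card {e \<in> ?F. v \<in> e} = card {e \<in> ?F. w \<in> e}"
    using optimal_degree[OF opt fin] V uv vw by auto
  have v: "{e \<in> ?F. v \<in> e \<and> u \<notin> e} = {e \<in> ?F. v \<in> e}"
    using red_blue_linked uv ne by fastforce
  then have "card (red_blue V ?c) = card ?F"
    using card_red_blue_clone[OF c fin V(1,2) ne(1)] deg by simp
  then have opt': "optimal n V ?c"
    using opt clique_free_clone[OF cf c V(2)] c by (simp add: optimal_def)
  have absent: "?c u v = Absent" "?c u w = Absent" "?c v w = Absent"
    using c vw ne by (auto simp: clone_def)
  \<comment> \<open>In the clone \<open>u\<close> is adjacent to neither \<open>v\<close> nor
    \<open>w\<close>, so the members through these two are the old ones avoiding
    \<open>u\<close>.\<close>
  have old: "{e \<in> red_blue V ?c. x \<in> e} = {e \<in> ?F. x \<in> e \<and> u \<notin> e}" if "x = v \<or> x = w" for x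
  proof -
    have "u \<notin> e" if "e \<in> red_blue V ?c" "x \<in> e" for e
      using red_blue_linked[OF that(1), of u x] that \<open>x = v \<or> x = w\<close> absent ne by auto
    then show ?thesis using red_blue_clone[OF c V(1,2) ne(1)] by auto
  qed
  have "card {e \<in> ?F. v \<in> e} = card {e \<in> ?F. w \<in> e \<and> u \<notin> e}"
    using optimal_degree[OF opt' fin V(2,3) absent(3)] old v by simp
  then have "card {e \<in> ?F. w \<in> e} = card {e \<in> ?F. w \<in> e \<and> u \<notin> e}" using deg by simp
  then have "{e \<in> ?F. w \<in> e \<and> u \<notin> e} = {e \<in> ?F. w \<in> e}"
    using fin by (intro card_subset_eq) auto
  then have none: "\<not> (\<exists>e\<in>?F. u \<in> e \<and> w \<in> e)" by blast
  \<comment> \<open>The pair is already linked, so making it red changes no clique.\<close>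
  have "clique_free n V (set_red u w c)"
    unfolding clique_free_def
  proof (intro allI impI)
    fix S assume S: "S \<subseteq> V" "pairwise (\<lambda>x y. set_red u w c x y \<noteq> Absent) S"
    have "c x y \<noteq> Absent" if "set_red u w c x y \<noteq> Absent" for x y
      using that uw coloring_sym[OF c, of u w] by (auto simp: set_red_def doubleton_eq_iff split: if_splits)
    then have "pairwise (\<lambda>x y. c x y \<noteq> Absent) S" using S(2) by (auto simp: pairwise_def)
    then show "card S < n" using cf S(1) by (simp add: clique_free_def)
  qed
  then show False using optimal_covers_pair[OF opt fin V(1,3) ne(2)] none by blast
qed

section \<open>The structure of optimal colourings\<close>

text \<open>The bound \<open>large\<close> leaves room for \<open>n - 1\<close> nonempty classes;
  \<open>n \<ge> 7\<close> gives \<open>n - 3 > 3\<close>, the inequality behind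
  \<open>no_red\<close>.\<close>

locale optimal_coloring =
  fixes n :: nat and V :: "'a set" and c :: "'a \<Rightarrow> 'a \<Rightarrow> link"
  assumes opt: "optimal n V c" and fin: "finite V"
    and large: "n \<le> Suc (card V)" and n: "n \<ge> 7"
begin

definition cls :: "'a \<Rightarrow> 'a set" where
  "cls x = {y \<in> V. c x y = Absent}"

lemma coloring_c: "coloring c" and clique_free_c: "clique_free n V c"
  using opt by (auto simp: optimal_def)

lemma cls_eq_iff:
  assumes "x \<in> V" "y \<in> V"
  shows "cls x = cls y \<longleftrightarrow> c x y = Absent"
proof
  assume "cls x = cls y"
  moreover have "y \<in> cls y" using assms coloring_c by (simp add: cls_def)
  ultimately show "c x y = Absent" unfolding cls_def by blast
next
  assume xy: "c x y = Absent"
  then have "c y x = Absent"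
    using coloring_sym[OF coloring_c] by metis
  have "c x z = Absent \<longleftrightarrow> c y z = Absent" if "z \<in> V" for z
    using optimal_absent_trans[OF opt fin assms(1,2) that xy]
      optimal_absent_trans[OF opt fin assms(2,1) that \<open>c y x = Absent\<close>] by blast
  then show "cls x = cls y" unfolding cls_def by blast
qed

lemma fibre_cls: "x \<in> V \<Longrightarrow> {y \<in> V. cls y = cls x} = cls x"
  using cls_eq_iff[of x] by (auto simp: cls_def)

lemma clique_iff_inj_on:
  assumes "S \<subseteq> V"
  shows "pairwise (\<lambda>x y. c x y \<noteq> Absent) S \<longleftrightarrow> inj_on cls S"
  using assms cls_eq_iff by (auto simp: pairwise_def inj_on_def subset_iff)

text \<open>A transversal of the classes is a clique, which gives fewer than \<open>n\<close>
  classes. With fewer than \<open>n - 1\<close>, two vertices share a class, and linking them in red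
  enlarges cliques by at most one vertex; \<open>optimal_covers_pair\<close> then puts a
  non-adjacent pair into a member.\<close>

lemma card_classes: "card (cls ` V) = n - 1"
proof -
  obtain S where S: "S \<subseteq> V" "inj_on cls S" "cls ` V = cls ` S"
    using subset_image_inj[of "cls ` V" cls V] by auto
  then have lt: "card (cls ` V) < n"
    using clique_free_c clique_iff_inj_on by (simp add: clique_free_def card_image)
  have "\<not> Suc (card (cls ` V)) < n"
  proof
    assume less: "Suc (card (cls ` V)) < n"
    have "\<not> inj_on cls V" using less large by (auto simp: card_image)
    then obtain x y where xy: "x \<in> V" "y \<in> V" "x \<noteq> y" "c x y = Absent"
      using cls_eq_iff by (auto simp: inj_on_def)
    have "clique_free n V (set_red x y c)"
      unfolding clique_free_def
    proof (intro allI impI)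
      fix S assume S: "S \<subseteq> V" "pairwise (\<lambda>a b. set_red x y c a b \<noteq> Absent) S"
      \<comment> \<open>Deleting \<open>x\<close> removes the only new link.\<close>
      have "pairwise (\<lambda>a b. c a b \<noteq> Absent) (S - {x})"
        using S(2) by (auto simp: pairwise_def set_red_def doubleton_eq_iff split: if_splits)
      then have "inj_on cls (S - {x})" using S(1) clique_iff_inj_on[of "S - {x}"] by auto
      then have "card (S - {x}) \<le> card (cls ` V)"
        using S(1) fin by (intro card_inj_on_le[where f = cls]) auto
      moreover have "card S \<le> Suc (card (S - {x}))"
        using diff_card_le_card_Diff[of "{x}" S] by simp
      ultimately show "card S < n" using less by simp
    qed
    then show False
      using optimal_covers_pair[OF opt fin] xy red_blue_linked by metis
  qed
  then show ?thesis using lt by simp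
qed

text \<open>Recolour every link blue. The triangles gained (\<open>M\<close>) cannot outnumber the
  red pairs lost (\<open>R\<close>), by optimality. Double counting the incidences between
  \<open>R\<close> and \<open>M\<close> gives \<open>(n - 3) * card R \<le> 3 * card M\<close>, so
  \<open>R\<close> is empty.\<close>

lemma no_red:
  assumes "x \<in> V" "y \<in> V"
  shows "c x y \<noteq> Red"
proof -
  define b where "b x y = (if c x y = Absent then Absent else Blue)" for x y
  let ?F = "red_blue V c" and ?T = "red_blue V b"
  define R where "R = {e \<in> ?F. card e = 2}"
  define B where "B = {e \<in> ?F. card e = 3}"
  define M where "M = ?T - B"
  have finite: "finite R" "finite B" "finite M" using fin by (auto simp: R_def B_def M_def)
  have T: "?T = {e. e \<subseteq> V \<and> card e = 3 \<and> inj_on cls e}"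
  proof -
    have "b x y \<noteq> Red" for x y by (simp add: b_def)
    then have "\<not> pairwise (\<lambda>x y. b x y = Red) e" if "card e = 2" for e
      using that by (auto simp: pairwise_def card_2_iff)
    moreover have "pairwise (\<lambda>x y. b x y = Blue) e \<longleftrightarrow> inj_on cls e" if "e \<subseteq> V" for e
      unfolding clique_iff_inj_on[OF that, symmetric] by (auto simp: pairwise_def b_def)
    ultimately show ?thesis unfolding red_blue_def by blast
  qed
  have "B \<subseteq> ?T" by (auto simp: B_def red_blue_def b_def pairwise_def)
  have "coloring b" using coloring_c by (auto simp: b_def coloring_def)
  moreover have "clique_free n V b"
    using clique_free_c by (auto simp: clique_free_def b_def pairwise_def split: if_splits)
  ultimately have "card ?T \<le> card ?F" using opt by (simp add: optimal_def)
  moreover have "card ?F = card R + card B"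
  proof -
    have "?F = R \<union> B" by (auto simp: R_def B_def red_blue_def)
    moreover have "R \<inter> B = {}" by (auto simp: R_def B_def)
    ultimately show ?thesis using card_Un_disjoint[OF finite(1,2)] by simp
  qed
  moreover have "card ?T = card M + card B"
    using \<open>B \<subseteq> ?T\<close> finite(2) fin card_mono[OF _ \<open>B \<subseteq> ?T\<close>] by (simp add: M_def card_Diff_subset)
  ultimately have M: "card M \<le> card R" by simp

  have low: "n - 3 \<le> card {t \<in> M. e \<subseteq> t}" if e: "e \<in> R" for e
  proof -
    obtain x y where xy: "e = {x, y}" "x \<noteq> y" using e by (auto simp: R_def card_2_iff)
    have V: "x \<in> V" "y \<in> V" and red: "c x y = Red"
      using e xy by (auto simp: R_def red_blue_def pairwise_def card_2_iff)
    \<comment> \<open>One representative of each class other than those of \<open>x\<close> and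
      \<open>y\<close>; each of them completes the red pair to a new triangle.\<close>
    obtain S where S: "S \<subseteq> V" "inj_on cls S" "cls ` V - {cls x, cls y} = cls ` S"
      using subset_image_inj[of "cls ` V - {cls x, cls y}" cls V] by auto
    have notin: "cls z \<noteq> cls x" "cls z \<noteq> cls y" if "z \<in> S" for z using S(3) that by blast+
    have "card (cls ` S) \<ge> card (cls ` V) - card {cls x, cls y}"
      unfolding S(3)[symmetric] by (rule diff_card_le_card_Diff) simp
    moreover have "card {cls x, cls y} \<le> 2" by (simp add: card_insert_if)
    ultimately have "n - 3 \<le> card S" using S(2) card_classes by (simp add: card_image)
    also have "card S \<le> card {t \<in> M. e \<subseteq> t}"
    proof (rule card_inj_on_le)
      show "inj_on (\<lambda>z. insert z e) S"
        using notin xy by (intro inj_onI) (metis insert_iff singletonD insertCI)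
      show "(\<lambda>z. insert z e) ` S \<subseteq> {t \<in> M. e \<subseteq> t}"
      proof
        fix t assume "t \<in> (\<lambda>z. insert z e) ` S"
        then obtain z where z: "z \<in> S" "t = {z, x, y}" using xy by auto
        have "z \<noteq> x" "z \<noteq> y" "z \<in> V" using notin[OF z(1)] z(1) S(1) by auto
        moreover have "cls x \<noteq> cls y" using cls_eq_iff[OF V] red by simp
        ultimately have "t \<in> ?T" using z V xy notin[OF z(1)] by (auto simp: T)
        moreover have "t \<notin> B" using z xy red by (auto simp: B_def red_blue_def pairwise_def)
        ultimately show "t \<in> {t \<in> M. e \<subseteq> t}" using z xy by (auto simp: M_def)
      qed
    qed (use finite in simp)
    finally show ?thesis .
  qed
  have up: "card {e \<in> R. e \<subseteq> t} \<le> 3" if t: "t \<in> M" for t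
  proof -
    have t: "card t = 3" "t \<subseteq> V" using t by (auto simp: M_def T)
    then have "finite t" using fin finite_subset by blast
    have "card {e \<in> R. e \<subseteq> t} \<le> card {e. e \<subseteq> t \<and> card e = 2}"
      using \<open>finite t\<close> by (intro card_mono) (auto simp: R_def)
    also have "\<dots> = 3" using n_subsets[OF \<open>finite t\<close>, of 2] t by (simp add: choose_two)
    finally show ?thesis .
  qed
  have "card R * (n - 3) \<le> (\<Sum>e\<in>R. card {t \<in> M. e \<subseteq> t})"
    using low sum_mono[of R "\<lambda>_. n - 3"] by simp
  also have "\<dots> = (\<Sum>t\<in>M. card {e \<in> R. e \<subseteq> t})"
    using sum.swap_restrict[OF finite(1,3), of "\<lambda>_ _. 1::nat" "(\<subseteq>)"] by simp
  also have "\<dots> \<le> card M * 3"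
    using sum_bounded_above[of M "\<lambda>t. card {e \<in> R. e \<subseteq> t}" 3] up by (simp add: mult.commute)
  also have "\<dots> \<le> card R * 3" using M by simp
  finally have "card R * (n - 3) \<le> card R * 3" .
  \<comment> \<open>Here \<open>n \<ge> 7\<close> enters: \<open>n - 3\<close> exceeds 3.\<close>
  then have "card R = 0" using n by (cases "card R = 0") auto
  then have "R = {}" using finite by simp
  then show ?thesis
    using red_blue_red[OF coloring_c assms] coloring_c assms unfolding R_def
    by (cases "x = y") auto
qed

lemma red_blue_eq: "red_blue V c = {e. e \<subseteq> V \<and> card e = 3 \<and> inj_on cls e}"
proof -
  have "c x y = Blue \<longleftrightarrow> c x y \<noteq> Absent" if "x \<in> V" "y \<in> V" for x y
    using no_red[OF that] by (cases "c x y") auto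
  then have blue: "pairwise (\<lambda>x y. c x y = Blue) e \<longleftrightarrow> inj_on cls e" if "e \<subseteq> V" for e
    using that clique_iff_inj_on[OF that] by (auto simp: pairwise_def subset_iff)
  have "\<not> pairwise (\<lambda>x y. c x y = Red) e" if "e \<subseteq> V" "card e = 2" for e
    using that no_red by (auto simp: pairwise_def card_2_iff)
  then show ?thesis using blue by (auto simp: red_blue_def)
qed

text \<open>If the class of \<open>u\<close> were larger by at least two, making \<open>u\<close> a
  twin of \<open>w\<close> would be a strict gain: members through \<open>u\<close> inject into
  members through \<open>w\<close> that avoid \<open>u\<close>, and the injection misses at least
  one.\<close>

lemma balanced:
  assumes V: "u \<in> V" "w \<in> V"
  shows "card (cls u) \<le> Suc (card (cls w))"
proof (rule ccontr)
  assume gap: "\<not> ?thesis"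
  let ?F = "red_blue V c"
  have cls_V: "cls x \<subseteq> V" for x by (auto simp: cls_def)
  have fin_cls: "finite (cls x)" for x using fin cls_V finite_subset by blast
  have self: "x \<in> V \<Longrightarrow> x \<in> cls x" for x using coloring_c by (simp add: cls_def)
  have in_cls: "x \<in> V \<Longrightarrow> y \<in> V \<Longrightarrow> x \<in> cls y \<longleftrightarrow> cls x = cls y" for x y
    using fibre_cls[of y] by auto
  have ne: "cls u \<noteq> cls w" "u \<noteq> w" using gap by auto
  have less: "card (cls w) < card (cls u - {u})" using gap self[OF V(1)] fin_cls by simp
  then obtain s where s: "s ` cls w \<subseteq> cls u - {u}" "inj_on s (cls w)"
    using card_le_inj[of "cls w" "cls u - {u}"] fin_cls by auto
  have "card (s ` cls w) < card (cls u - {u})" using less s(2) by (simp add: card_image)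
  then have "\<not> cls u - {u} \<subseteq> s ` cls w" using fin_cls card_mono[of "s ` cls w"] by (meson finite_imageI not_le)
  then obtain a where a: "a \<in> cls u" "a \<noteq> u" "a \<notin> s ` cls w" by blast
  \<comment> \<open>A third class supplies the remaining vertex \<open>z\<close> of the missed
    triangle.\<close>
  have "card {cls u, cls w} < card (cls ` V)" using card_classes n ne by simp
  then have "\<not> cls ` V \<subseteq> {cls u, cls w}" using card_mono[of "{cls u, cls w}"] by (meson finite.intros not_le)
  then obtain z where z: "z \<in> V" "cls z \<noteq> cls u" "cls z \<noteq> cls w" by blast
  \<comment> \<open>The map \<open>h\<close> exchanges the roles of the two classes, sending
    \<open>u\<close> to \<open>w\<close> and \<open>cls w\<close> into the rest of
    \<open>cls u\<close>; \<open>t\<close> is the induced swap of classes.\<close>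
  define h where "h x = (if x = u then w else if x \<in> cls w then s x else x)" for x
  define t where "t Q = (if Q = cls u then cls w else if Q = cls w then cls u else Q)" for Q
  have "inj t" by (auto simp: inj_def t_def)
  \<comment> \<open>A member through \<open>u\<close> meets \<open>cls u\<close> only in
    \<open>u\<close>, so it lies in \<open>D\<close>, and \<open>h\<close> need only be injective
    there.\<close>
  define D where "D = V - (cls u - {u})"
  have s_V: "s x \<in> V" "cls (s x) = cls u" "s x \<noteq> u" if "x \<in> cls w" for x
  proof -
    have "s x \<in> cls u - {u}" using s(1) that by blast
    then show "s x \<in> V" "cls (s x) = cls u" "s x \<noteq> u"
      using cls_V[of u] in_cls[of "s x" u] V by auto
  qed
  have cls_h: "cls (h x) = t (cls x)" if "x \<in> D" for x
    using that s_V in_cls V ne by (auto simp: D_def h_def t_def)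
  have h_V: "h x \<in> V" "h x \<noteq> u" if "x \<in> D" for x
    using that s_V V ne by (auto simp: D_def h_def)
  have inj: "inj_on h D"
  proof (rule inj_onI)
    fix x y assume xy: "x \<in> D" "y \<in> D" "h x = h y"
    then have "t (cls x) = t (cls y)" using cls_h by metis
    then have eq: "cls x = cls y" using \<open>inj t\<close> by (auto dest: injD)
    have xyV: "x \<in> V" "y \<in> V" using xy by (auto simp: D_def)
    consider "cls x = cls u" | "cls x = cls w" | "cls x \<noteq> cls u" "cls x \<noteq> cls w" by blast
    then show "x = y"
    proof cases
      case 1
      then show ?thesis using xy eq in_cls[OF xyV(1) V(1)] in_cls[OF xyV(2) V(1)] by (auto simp: D_def)
    next
      case 2
      then have "x \<in> cls w" "y \<in> cls w" "x \<noteq> u" "y \<noteq> u" using eq xyV in_cls V ne by auto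
      then show ?thesis using xy(3) s(2) by (auto simp: h_def dest: inj_onD)
    next
      case 3
      then have "x \<notin> cls w" "y \<notin> cls w" "x \<noteq> u" "y \<noteq> u" using eq xyV in_cls V by auto
      then show ?thesis using xy(3) by (simp add: h_def)
    qed
  qed
  let ?U = "{e \<in> ?F. u \<in> e}" and ?W = "{e \<in> ?F. w \<in> e \<and> u \<notin> e}"
  have U_D: "e \<subseteq> D" if "e \<in> ?U" for e
  proof
    fix x assume x: "x \<in> e"
    have "e \<subseteq> V" "inj_on cls e" using that by (auto simp: red_blue_eq)
    then show "x \<in> D" using x that in_cls[of x u] V by (auto simp: D_def dest: inj_onD)
  qed
  have img: "(`) h ` ?U \<subseteq> ?W"
  proof
    fix d assume "d \<in> (`) h ` ?U"
    then obtain e where e: "e \<in> ?U" "d = h ` e" by auto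
    have "inj_on (t \<circ> cls) e" using e(1) \<open>inj t\<close>
      by (auto simp: red_blue_eq inj_on_def dest: injD)
    then have "inj_on (cls \<circ> h) e"
      using cls_h U_D[OF e(1)] by (subst inj_on_cong[of _ _ "t \<circ> cls"]) auto
    then have "inj_on cls d" unfolding e(2) by (rule inj_on_imageI)
    moreover have "card d = 3" using e inj_on_subset[OF inj U_D[OF e(1)]]
      by (simp add: card_image red_blue_eq)
    moreover have "d \<subseteq> V" "u \<notin> d" using e(2) U_D[OF e(1)] h_V by blast+
    moreover have "w \<in> d" using e by (auto simp: h_def intro: rev_image_eqI)
    ultimately show "d \<in> ?W" by (simp add: red_blue_eq)
  qed
  have new: "{w, a, z} \<in> ?W"
  proof -
    have "cls a = cls u" "a \<in> V" using a in_cls[of a u] V cls_V by auto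
    moreover have "w \<noteq> a" "w \<noteq> z" "a \<noteq> z" "u \<noteq> z" using \<open>cls a = cls u\<close> z ne by auto
    ultimately show ?thesis using V z(1) z(2,3)[symmetric] ne a(2)
      by (simp add: red_blue_eq)
  qed
  \<comment> \<open>Within \<open>D\<close>, only vertices of \<open>cls w\<close> are sent into
    \<open>cls u\<close>, by \<open>s\<close>, and \<open>s\<close> misses \<open>a\<close>.\<close>
  have "{w, a, z} \<notin> (`) h ` ?U"
  proof
    assume "{w, a, z} \<in> (`) h ` ?U"
    then obtain e where e: "e \<in> ?U" "{w, a, z} = h ` e" by auto
    then obtain x where x: "x \<in> e" "a = h x" by blast
    then have "x \<in> D" using U_D e by blast
    have "cls a = cls u" using a in_cls[of a u] V cls_V by auto
    then show False using x(2) \<open>x \<in> D\<close> a ne by (auto simp: h_def D_def split: if_splits)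
  qed
  then have "(`) h ` ?U \<subset> ?W" using img new by blast
  then have "card ((`) h ` ?U) < card ?W" using fin by (intro psubset_card_mono) auto
  moreover have "inj_on ((`) h) ?U"
    using U_D by (intro inj_on_image inj_on_subset[OF inj]) blast
  ultimately have "card ?U < card ?W" by (simp add: card_image)
  then have "card ?F < card (red_blue V (clone u w c))"
    using card_red_blue_clone[OF coloring_c fin V ne(2)] by simp
  then show False
    using opt clique_free_clone[OF clique_free_c coloring_c V(2)] coloring_c
    by (auto simp: optimal_def not_le[symmetric])
qed

end

section \<open>From 3-graphs to coloured graphs\<close>

text \<open>Take \<open>S\<close> of maximal deficiency. A violation of Hall's condition outside
  \<open>S\<close> could be added to \<open>S\<close>, and one among the covered pairs could be
  removed together with the edges meeting it; either change would raise the deficiency.\<close>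

lemma shadow_matching:
  fixes E :: "'a set set"
  defines "shadow e \<equiv> {p. p \<subseteq> e \<and> card p = 2}"
  assumes "finite E" and "\<And>e. e \<in> E \<Longrightarrow> finite e"
  obtains S f m where "S \<subseteq> E"
    and "inj_on f (E - S)" and "\<forall>e\<in>E - S. f e \<in> shadow e - \<Union>(shadow ` S)"
    and "inj_on m (\<Union>(shadow ` S))" and "\<forall>p\<in>\<Union>(shadow ` S). m p \<in> S \<and> p \<subseteq> m p"
proof -
  define N where "N X = \<Union>(shadow ` X)" for X
  define P where "P = N E"
  have "finite (shadow e)" if "e \<in> E" for e
    using assms(3)[OF that] unfolding shadow_def by simp
  then have finP: "finite P" using assms(2) by (auto simp: P_def N_def)
  have N_P: "N X \<subseteq> P" if "X \<subseteq> E" for X using that by (auto simp: P_def N_def)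
  \<comment> \<open>The deficiency \<open>card X - card (N X)\<close>, shifted by \<open>card P\<close> to stay in the naturals.\<close>
  define f where "f X = card X + card (P - N X)" for X
  have "\<exists>S. S \<subseteq> E \<and> (\<forall>X. X \<subseteq> E \<longrightarrow> f X \<le> f S)"
  proof (rule ex_has_greatest_nat)
    show "{} \<subseteq> E" by simp
    show "\<forall>X. X \<subseteq> E \<longrightarrow> f X < Suc (card E + card P)"
      using assms(2) finP by (auto simp: f_def less_Suc_eq_le intro!: add_mono card_mono)
  qed
  then obtain S where S: "S \<subseteq> E" and max: "\<And>X. X \<subseteq> E \<Longrightarrow> f X \<le> f S" by blast
  have finS: "finite S" using S assms(2) finite_subset by blast

  have "\<exists>g. inj_on g (E - S) \<and> (\<forall>e\<in>E - S. g e \<in> shadow e - N S)"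
  proof (rule hall)
    show "finite (shadow e - N S)" if "e \<in> E - S" for e
      using \<open>\<And>e. e \<in> E \<Longrightarrow> finite (shadow e)\<close> that by simp
    fix J assume J: "J \<subseteq> E - S"
    let ?A = "\<Union>((\<lambda>e. shadow e - N S) ` J)"
    have "finite J" using J assms(2) finite_subset by blast
    have "f (S \<union> J) \<le> f S" using J S by (intro max) auto
    moreover have "card (S \<union> J) = card S + card J"
      using J finS \<open>finite J\<close> by (intro card_Un_disjoint) auto
    moreover have "card (P - N S) = card (P - N (S \<union> J)) + card ?A"
    proof -
      have "P - N S = (P - N (S \<union> J)) \<union> ?A" using N_P[of J] J by (auto simp: N_def)
      moreover have "(P - N (S \<union> J)) \<inter> ?A = {}" by (auto simp: N_def)
      moreover have "finite ?A" by (rule finite_subset[OF _ finP]) (use N_P[of J] J in \<open>auto simp: N_def\<close>)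
      ultimately show ?thesis using finP by (simp add: card_Un_disjoint)
    qed
    ultimately show "card J \<le> card ?A" by (simp add: f_def)
  qed (use assms(2) in simp)
  then obtain g where g: "inj_on g (E - S)" "\<forall>e\<in>E - S. g e \<in> shadow e - N S" by blast

  have "\<exists>m. inj_on m (N S) \<and> (\<forall>p\<in>N S. m p \<in> {e \<in> S. p \<subseteq> e})"
  proof (rule hall)
    show "finite (N S)" using N_P[OF S] finP finite_subset by blast
    show "finite {e \<in> S. p \<subseteq> e}" for p using finS by simp
    fix J assume J: "J \<subseteq> N S"
    let ?A = "\<Union>((\<lambda>p. {e \<in> S. p \<subseteq> e}) ` J)"
    have "finite J" by (rule finite_subset[OF subset_trans[OF J N_P[OF S]] finP])
    have A: "?A \<subseteq> S" by auto
    have "f (S - ?A) \<le> f S" using S by (intro max) auto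
    moreover have "card S = card (S - ?A) + card ?A"
      using finS A card_mono[OF finS A] by (simp add: card_Diff_subset finite_subset[OF A])
    \<comment> \<open>Removing from \<open>S\<close> all edges that contain a pair of
      \<open>J\<close> uncovers every pair of \<open>J\<close>.\<close>
    moreover have "card (P - N S) + card J \<le> card (P - N (S - ?A))"
    proof -
      have "card (P - N S) + card J = card ((P - N S) \<union> J)"
      proof (rule card_Un_disjoint[symmetric])
        show "(P - N S) \<inter> J = {}" using J by blast
      qed (use finP \<open>finite J\<close> in simp_all)
      also have "\<dots> \<le> card (P - N (S - ?A))"
      proof (rule card_mono)
        have "N (S - ?A) \<subseteq> N S" unfolding N_def by blast
        moreover have "J \<inter> N (S - ?A) = {}" unfolding N_def shadow_def by blast
        moreover have "J \<subseteq> P" using J N_P[OF S] by (rule subset_trans)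
        ultimately show "(P - N S) \<union> J \<subseteq> P - N (S - ?A)" by blast
      qed (use finP in simp)
      finally show ?thesis .
    qed
    ultimately show "card J \<le> card ?A" by (simp add: f_def)
  qed
  then obtain m where "inj_on m (N S)" "\<forall>p\<in>N S. m p \<in> {e \<in> S. p \<subseteq> e}" by blast
  then show thesis using that[OF S g[unfolded N_def], of m] by (auto simp: N_def)
qed

text \<open>Any \<open>n\<close> vertices of \<open>S\<close> form a core, with \<open>m\<close>
  supplying the edge of each pair; \<open>n \<ge> 1\<close> keeps the vertex set nonempty.\<close>

lemma berge3_of_matching:
  fixes H :: "'a hypergraph"
  assumes H: "three_graph H" and n: "n \<ge> 1"
    and S: "S \<subseteq> verts H" "n \<le> card S"
    and m: "inj_on m {p. p \<subseteq> S \<and> card p = 2}"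
      "\<And>p. p \<subseteq> S \<Longrightarrow> card p = 2 \<Longrightarrow> m p \<in> edges H \<and> p \<subseteq> m p"
  shows "\<not> family_free (berge3 n) H"
proof -
  have hyp: "hypergraph H" and three: "\<And>e. e \<in> edges H \<Longrightarrow> card e = 3"
    using H by (auto simp: three_graph_def)
  then have finV: "finite (verts H)" and EV: "edges H \<subseteq> Pow (verts H)"
    by (auto simp: hypergraph_def)
  obtain v where v: "v ` {1..n} \<subseteq> S" "inj_on v {1..n}"
    using card_le_inj[of "{1..n}" S] S finV finite_subset by auto
  define e where "e = (\<lambda>(i, j). m {v i, v j})"
  define K where "K = (v ` {1..n} \<union> \<Union>(e ` index_pairs n), e ` index_pairs n)"
  have pair: "{v i, v j} \<subseteq> S \<and> card {v i, v j} = 2" if "(i, j) \<in> index_pairs n" for i j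
  proof -
    have ij: "i \<in> {1..n}" "j \<in> {1..n}" "i \<noteq> j" using that by (auto simp: index_pairs_def)
    then have "v i \<noteq> v j" using v(2) by (auto dest: inj_onD)
    then show ?thesis using ij v(1) by auto
  qed
  have eH: "e ` index_pairs n \<subseteq> edges H" using pair m(2) by (auto simp: e_def)
  have "inj_on e (index_pairs n)"
  proof (rule inj_onI)
    fix x y assume xy: "x \<in> index_pairs n" "y \<in> index_pairs n" "e x = e y"
    obtain i j k l where ij: "x = (i, j)" "y = (k, l)" by (cases x, cases y) auto
    have "m {v i, v j} = m {v k, v l}" using xy ij by (simp add: e_def)
    then have "{v i, v j} = {v k, v l}"
      by (rule inj_onD[OF m(1)]) (use xy ij pair[of i j] pair[of k l] in simp_all)
    moreover have "i \<in> {1..n}" "j \<in> {1..n}" "k \<in> {1..n}" "l \<in> {1..n}" "i < j" "k < l"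
      using xy ij by (auto simp: index_pairs_def)
    moreover from this have "v i = v l \<longleftrightarrow> i = l" "v j = v k \<longleftrightarrow> j = k"
      "v i = v k \<longleftrightarrow> i = k" "v j = v l \<longleftrightarrow> j = l"
      using v(2) by (auto simp: inj_on_eq_iff)
    \<comment> \<open>The crossed case \<open>i = l\<close>, \<open>j = k\<close> is excluded by
      \<open>i < j\<close> and \<open>k < l\<close>.\<close>
    ultimately show "x = y" unfolding ij by (auto simp: doubleton_eq_iff)
  qed
  moreover have "\<forall>(i, j)\<in>index_pairs n. {v i, v j} \<subseteq> e (i, j)"
    using pair m(2) unfolding e_def by blast
  moreover have subV: "verts K \<subseteq> verts H"
  proof -
    have "\<Union>(e ` index_pairs n) \<subseteq> verts H" using eH EV by blast
    then show ?thesis using v(1) S(1) by (auto simp: K_def)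
  qed
  moreover have "hypergraph K"
    using subV finV finite_subset n eH hyp by (auto simp: hypergraph_def K_def)
  moreover have "three_graph K"
    using \<open>hypergraph K\<close> eH three by (auto simp: three_graph_def K_def)
  ultimately have "K \<in> berge3 n" "subhypergraph K H"
    using v(2) eH hyp by (auto simp: berge3_def subhypergraph_def K_def)
  then show ?thesis by (auto simp: family_free_def)
qed

text \<open>Edges in \<open>S\<close> become blue triangles and every other edge is traded for its
  own red pair, so the count does not drop. The last conclusion serves uniqueness: without red pairs
  all edges lie in \<open>S\<close>.\<close>

lemma red_blue_dominates:
  fixes H :: "'a hypergraph"
  assumes H: "three_graph H" and free: "family_free (berge3 n) H" and n: "n \<ge> 1"
  obtains c where "coloring c" and "clique_free n (verts H) c"
    and "card (edges H) \<le> card (red_blue (verts H) c)"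
    and "(\<forall>x\<in>verts H. \<forall>y\<in>verts H. c x y \<noteq> Red) \<Longrightarrow> edges H \<subseteq> red_blue (verts H) c"
proof -
  let ?V = "verts H" and ?E = "edges H"
  have finV: "finite ?V" and EV: "?E \<subseteq> Pow ?V" and three: "\<And>e. e \<in> ?E \<Longrightarrow> card e = 3"
    using H by (auto simp: three_graph_def hypergraph_def)
  have finE: "finite ?E" using finV EV finite_subset by (metis finite_Pow_iff)
  have fine: "finite e" if "e \<in> ?E" for e using that EV finV finite_subset by blast
  obtain S f m where S: "S \<subseteq> ?E" and f: "inj_on f (?E - S)"
      "\<forall>e\<in>?E - S. f e \<in> {p. p \<subseteq> e \<and> card p = 2} - (\<Union>e\<in>S. {p. p \<subseteq> e \<and> card p = 2})"
    and m: "inj_on m (\<Union>e\<in>S. {p. p \<subseteq> e \<and> card p = 2})"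
      "\<forall>p\<in>(\<Union>e\<in>S. {p. p \<subseteq> e \<and> card p = 2}). m p \<in> S \<and> p \<subseteq> m p"
    by (rule shadow_matching[OF finE fine], assumption) (rule that)
  define B where "B = (\<Union>e\<in>S. {p. p \<subseteq> e \<and> card p = 2})"
  define R where "R = f ` (?E - S)"
  define c where "c x y = (if {x, y} \<in> B then Blue else if {x, y} \<in> R then Red else Absent)" for x y
  have two: "card p = 2" if "p \<in> B \<union> R" for p using that f(2) by (auto simp: B_def R_def)
  have disj: "B \<inter> R = {}" using f(2) by (auto simp: B_def R_def)
  have RV: "p \<subseteq> ?V" if "p \<in> R" for p using that f(2) EV unfolding R_def by blast
  have "{x, x} \<notin> B \<union> R" for x using two[of "{x, x}"] by auto
  then have col: "coloring c" by (auto simp: coloring_def c_def insert_commute)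

  have "clique_free n ?V c"
    unfolding clique_free_def
  proof (intro allI impI, rule ccontr)
    fix T assume T: "T \<subseteq> ?V" "pairwise (\<lambda>x y. c x y \<noteq> Absent) T" "\<not> card T < n"
    \<comment> \<open>The edge owned by a coloured pair: its match in \<open>S\<close> if blue, the
      edge that selected it if red. These ranges are disjoint, so \<open>M\<close> is injective, and
      an \<open>n\<close>-clique would yield a Berge copy.\<close>
    define M where "M p = (if p \<in> B then m p else inv_into (?E - S) f p)" for p
    have in_BR: "p \<in> B \<union> R" if "p \<subseteq> T" "card p = 2" for p
      using that T(2) by (auto simp: card_2_iff pairwise_def c_def split: if_splits)
    have MB: "M p \<in> S" "p \<subseteq> M p" if "p \<in> B" for p
      using that m(2) by (auto simp: M_def B_def)
    have MR: "M p \<in> ?E - S" "f (M p) = p" if "p \<in> R" for p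
    proof -
      have "M p = inv_into (?E - S) f p" using that disj by (auto simp: M_def)
      then show "M p \<in> ?E - S" "f (M p) = p"
        using that inv_into_into[of p f] f_inv_into_f[of p f] unfolding R_def by metis+
    qed
    have "p \<subseteq> M p" if "p \<in> R" for p using MR[OF that] f(2) by force
    then have ME: "M p \<in> ?E \<and> p \<subseteq> M p" if "p \<in> B \<union> R" for p
      using that MB MR S by auto
    have "inj_on M (B \<union> R)"
    proof (rule inj_onI)
      fix p q assume pq: "p \<in> B \<union> R" "q \<in> B \<union> R" "M p = M q"
      then consider "p \<in> B" "q \<in> B" | "p \<in> R" "q \<in> R" using MB(1) MR(1) by (metis DiffD2 UnE)
      then show "p = q"
      proof cases
        case 1
        then show ?thesis using pq(3) m(1) by (auto simp: M_def B_def dest: inj_onD)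
      next
        case 2
        then show ?thesis using pq(3) MR(2) by metis
      qed
    qed
    then have "inj_on M {p. p \<subseteq> T \<and> card p = 2}"
      by (rule inj_on_subset) (use in_BR in blast)
    then have "\<not> family_free (berge3 n) H"
      using T ME in_BR by (intro berge3_of_matching[OF H n T(1)]) auto
    then show False using free by simp
  qed
  moreover have blue: "S \<subseteq> red_blue ?V c"
  proof
    fix e assume e: "e \<in> S"
    have "{x, y} \<in> B" if "x \<in> e" "y \<in> e" "x \<noteq> y" for x y
      unfolding B_def using that e by auto
    then show "e \<in> red_blue ?V c"
      using e S three EV by (auto simp: red_blue_def pairwise_def c_def)
  qed
  moreover have red: "R \<subseteq> red_blue ?V c"
  proof
    fix p assume p: "p \<in> R"
    then obtain x y where xy: "p = {x, y}" "x \<noteq> y" using two by (metis UnCI card_2_iff)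
    then have "c x y = Red" using p disj by (auto simp: c_def)
    then show "p \<in> red_blue ?V c" using red_blue_red[OF col] RV[OF p] xy by simp
  qed
  moreover have "card ?E \<le> card (red_blue ?V c)"
  proof -
    have "card ?E = card S + card (?E - S)"
      using S finE by (metis card_Diff_subset card_mono finite_subset le_add_diff_inverse)
    also have "\<dots> = card S + card R" using f(1) by (simp add: R_def card_image)
    also have "\<dots> = card (S \<union> R)"
    proof (rule card_Un_disjoint[symmetric])
      show "S \<inter> R = {}" using two three S by fastforce
    qed (use S finE finite_subset in \<open>auto simp: R_def\<close>)
    also have "\<dots> \<le> card (red_blue ?V c)" using blue red finV by (intro card_mono) auto
    finally show ?thesis .
  qed
  moreover have "?E \<subseteq> red_blue ?V c" if no: "\<forall>x\<in>?V. \<forall>y\<in>?V. c x y \<noteq> Red"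
  proof -
    have "R = {}"
    proof (rule ccontr)
      assume "R \<noteq> {}"
      then obtain p where p: "p \<in> R" by blast
      then obtain x y where xy: "p = {x, y}" "x \<noteq> y" using two by (metis UnCI card_2_iff)
      then have "c x y = Red" using p disj by (auto simp: c_def)
      then show False using no RV[OF p] xy by simp
    qed
    then show ?thesis using blue by (auto simp: R_def)
  qed
  ultimately show thesis using that[OF col] by blast
qed

section \<open>Balanced partitions\<close>

text \<open>Sizes are the minimum \<open>m\<close> or \<open>Suc m\<close>, so \<open>card V\<close>
  is \<open>m\<close> times the number of parts plus the number of larger parts: this is division
  with remainder.\<close>

lemma balanced_fibres:
  fixes p :: "'a \<Rightarrow> 'i"
  defines "s i A \<equiv> card {z \<in> A. p z = i}"
  assumes fin: "finite V" and "V \<noteq> {}"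
    and bal: "\<And>i j. i \<in> p ` V \<Longrightarrow> j \<in> p ` V \<Longrightarrow> s i V \<le> Suc (s j V)"
  shows "i \<in> p ` V \<Longrightarrow> s i V \<in> {card V div card (p ` V), Suc (card V div card (p ` V))}"
    and "card {i \<in> p ` V. s i V = Suc (card V div card (p ` V))} = card V mod card (p ` V)"
proof -
  let ?I = "p ` V" and ?s = "\<lambda>i. s i V"
  define m where "m = Min (?s ` ?I)"
  define J where "J = {i \<in> ?I. ?s i = Suc m}"
  have finI: "finite ?I" and "?I \<noteq> {}" using assms by auto
  then have "m \<in> ?s ` ?I" unfolding m_def by (intro Min_in) auto
  then obtain k where k: "k \<in> ?I" "?s k = m" by auto
  have two: "?s i = m \<or> ?s i = Suc m" if "i \<in> ?I" for i
  proof -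
    have "m \<le> ?s i" unfolding m_def using finI that by (intro Min_le) auto
    then show ?thesis using bal[OF that k(1)] k(2) by auto
  qed
  have "card V = (\<Sum>i\<in>?I. ?s i)"
    unfolding s_def card_eq_sum using fin by (rule sum.image_gen)
  also have "\<dots> = (\<Sum>i\<in>?I. m + (if i \<in> J then 1 else 0))"
    using two by (intro sum.cong) (auto simp: J_def)
  also have "\<dots> = m * card ?I + card J"
  proof -
    have "?I \<inter> J = J" by (auto simp: J_def)
    then show ?thesis using finI by (simp add: sum.distrib sum.If_cases)
  qed
  finally have card: "card V = m * card ?I + card J" .
  \<comment> \<open>A part of minimal size is not in \<open>J\<close>, which makes the remainder
    strictly smaller than the divisor.\<close>
  have "k \<notin> J" using k by (simp add: J_def)
  moreover have "J \<subseteq> ?I" by (auto simp: J_def)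
  ultimately have "J \<subset> ?I" using k(1) by blast
  then have "card J < card ?I" using finI by (rule psubset_card_mono[rotated])
  then have div: "card V div card ?I = m" "card V mod card ?I = card J" by (simp_all add: card)
  show "i \<in> ?I \<Longrightarrow> ?s i \<in> {card V div card ?I, Suc (card V div card ?I)}"
    using two div by auto
  show "card {i \<in> ?I. ?s i = Suc (card V div card ?I)} = card V mod card ?I"
    using div by (simp add: J_def)
qed

text \<open>The part sizes with multiplicities are determined by the totals. Larger parts are
  matched with larger and smaller with smaller, and bijections between matched parts are
  glued.\<close>

lemma balanced_partitions_bij:
  fixes p :: "'a \<Rightarrow> 'i" and q :: "'b \<Rightarrow> 'j"
  assumes fin: "finite V" "finite W" and card: "card V = card W" "card (p ` V) = card (q ` W)"
    and balp: "\<And>i j. i \<in> p ` V \<Longrightarrow> j \<in> p ` V \<Longrightarrow>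
      card {z \<in> V. p z = i} \<le> Suc (card {z \<in> V. p z = j})"
    and balq: "\<And>i j. i \<in> q ` W \<Longrightarrow> j \<in> q ` W \<Longrightarrow>
      card {z \<in> W. q z = i} \<le> Suc (card {z \<in> W. q z = j})"
  shows "\<exists>g. bij_betw g V W \<and> (\<forall>x\<in>V. \<forall>y\<in>V. q (g x) = q (g y) \<longleftrightarrow> p x = p y)"
proof (cases "V = {}")
  case True
  then show ?thesis using card fin by (auto simp: bij_betw_def)
next
  case False
  then have "W \<noteq> {}" using card fin by auto
  let ?m = "card V div card (p ` V)"
  define s where "s i = card {z \<in> V. p z = i}" for i
  define t where "t j = card {z \<in> W. q z = j}" for j
  define J where "J = {i \<in> p ` V. s i = Suc ?m}"
  define K where "K = {j \<in> q ` W. t j = Suc ?m}"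
  have s: "i \<in> p ` V \<Longrightarrow> s i \<in> {?m, Suc ?m}" and J: "card J = card V mod card (p ` V)" for i
    using balanced_fibres[OF fin(1) False balp] unfolding s_def J_def by blast+
  have t: "j \<in> q ` W \<Longrightarrow> t j \<in> {?m, Suc ?m}" and K: "card K = card V mod card (p ` V)" for j
    using balanced_fibres[OF fin(2) \<open>W \<noteq> {}\<close> balq, folded card] unfolding t_def K_def by blast+
  have sub: "J \<subseteq> p ` V" "K \<subseteq> q ` W" by (auto simp: J_def K_def)
  have finJK: "finite J" "finite K" using sub fin finite_subset by blast+
  obtain f1 where f1: "bij_betw f1 J K"
    using finite_same_card_bij[OF finJK] J K by auto
  have "card (p ` V - J) = card (q ` W - K)"
    using sub finJK J K card by (simp add: card_Diff_subset)
  then obtain f2 where f2: "bij_betw f2 (p ` V - J) (q ` W - K)"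
    using finite_same_card_bij[of "p ` V - J" "q ` W - K"] fin by auto
  define f where "f i = (if i \<in> J then f1 i else f2 i)" for i
  have "bij_betw f (J \<union> (p ` V - J)) (K \<union> (q ` W - K))"
    unfolding f_def by (rule bij_betw_disjoint_Un[OF f1 f2]) auto
  then have f: "bij_betw f (p ` V) (q ` W)" using sub by (simp add: Un_absorb1)
  have "s i = t (f i)" if i: "i \<in> p ` V" for i
  proof (cases "i \<in> J")
    case True
    then have "f i \<in> K" using f1 by (auto simp: f_def bij_betw_def)
    then show ?thesis using True by (simp add: J_def K_def)
  next
    case False
    then have "f i \<in> q ` W - K" using f2 i by (auto simp: f_def bij_betw_def)
    then show ?thesis using False i s[of i] t[of "f i"] by (auto simp: J_def K_def)
  qed
  then have "\<forall>i\<in>p ` V. \<exists>h. bij_betw h {z \<in> V. p z = i} {z \<in> W. q z = f i}"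
    using fin unfolding s_def t_def by (intro ballI finite_same_card_bij) auto
  then obtain h where h: "\<And>i. i \<in> p ` V \<Longrightarrow> bij_betw (h i) {z \<in> V. p z = i} {z \<in> W. q z = f i}"
    by metis
  define g where "g x = h (p x) x" for x
  have g: "g x \<in> W" "q (g x) = f (p x)" if "x \<in> V" for x
    using h[of "p x"] that unfolding g_def bij_betw_def by blast+
  have eq: "q (g x) = q (g y) \<longleftrightarrow> p x = p y" if "x \<in> V" "y \<in> V" for x y
  proof -
    have "inj_on f (p ` V)" using f by (simp add: bij_betw_def)
    then have "f (p x) = f (p y) \<longleftrightarrow> p x = p y" using that by (intro inj_on_eq_iff) auto
    then show ?thesis using that g by simp
  qed
  have "inj_on g V"
  proof (rule inj_onI)
    fix x y assume xy: "x \<in> V" "y \<in> V" "g x = g y"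
    then have "p x = p y" using eq by metis
    then have "h (p x) x = h (p x) y" using xy by (simp add: g_def)
    then show "x = y" using h[of "p x"] xy \<open>p x = p y\<close> by (auto simp: bij_betw_def dest: inj_onD)
  qed
  moreover have "g ` V = W"
    using g(1) card(1) fin \<open>inj_on g V\<close> by (intro card_subset_eq) (auto simp: card_image)
  ultimately show ?thesis using eq by (auto simp: bij_betw_def)
qed

section \<open>The balanced complete multipartite 3-graph is extremal\<close>

text \<open>Brings the edges into the form of \<open>red_blue_eq\<close>, with the residue in the
  role of \<open>cls\<close>.\<close>

lemma edges_T3:
  assumes "k > 0"
  shows "edges (T3 N k) = {e. e \<subseteq> {..<N} \<and> card e = 3 \<and> inj_on (\<lambda>x. x mod k) e}"
proof -
  have "(\<forall>i\<in>{..<k}. card (e \<inter> residue_part N k i) \<le> 1) \<longleftrightarrow> inj_on (\<lambda>x. x mod k) e"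
    if e: "e \<subseteq> {..<N}" for e
  proof -
    have "finite e" using e finite_subset by blast
    then have "card (e \<inter> residue_part N k i) \<le> 1 \<longleftrightarrow>
        (\<forall>x\<in>e. \<forall>y\<in>e. x mod k = i \<longrightarrow> y mod k = i \<longrightarrow> x = y)" for i
      using e by (auto simp: card_le_Suc0_iff_eq residue_part_def)
    moreover have "x mod k \<in> {..<k}" for x using assms by simp
    ultimately show ?thesis unfolding inj_on_def by metis
  qed
  then show ?thesis using residue_part_Union[OF assms, of N]
    by (auto simp: T3_def complete_partite3_def)
qed

lemma verts_T3 [simp]: "k > 0 \<Longrightarrow> verts (T3 N k) = {..<N}"
  using residue_part_Union[of k N] by (simp add: T3_def complete_partite3_def)

lemma T3_three_graph: "k > 0 \<Longrightarrow> N > 0 \<Longrightarrow> three_graph (T3 N k)"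
  by (auto simp: three_graph_def hypergraph_def edges_T3 lessThan_empty_iff)

text \<open>By pigeonhole two of the \<open>n\<close> core vertices share a residue, yet they must
  lie in a common edge.\<close>

lemma T3_family_free:
  assumes "k > 0" "k < n"
  shows "family_free (berge3 n) (T3 N k)"
  unfolding family_free_def
proof
  assume "\<exists>K\<in>berge3 n. subhypergraph K (T3 N k)"
  then obtain K v e where K: "edges K \<subseteq> edges (T3 N k)" and v: "inj_on v {1..n}"
    and cover: "\<forall>(i, j)\<in>index_pairs n. {v i, v j} \<subseteq> e (i, j)"
    and eK: "edges K = e ` index_pairs n"
    by (auto simp: berge3_def subhypergraph_def)
  have "card ((\<lambda>i. v i mod k) ` {1..n}) \<le> card {..<k}"
    using assms by (intro card_mono) auto
  then have "\<not> inj_on (\<lambda>i. v i mod k) {1..n}" using assms by (auto dest: card_image)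
  then obtain i j where ij: "i \<in> {1..n}" "j \<in> {1..n}" "i < j" "v i mod k = v j mod k"
    unfolding inj_on_def by (metis linorder_neqE_nat)
  then have p: "(i, j) \<in> index_pairs n" by (auto simp: index_pairs_def)
  then have "e (i, j) \<in> edges (T3 N k)" using K eK by blast
  then have "inj_on (\<lambda>x. x mod k) (e (i, j))" using edges_T3[OF assms(1)] by simp
  moreover have "{v i, v j} \<subseteq> e (i, j)" using cover p by blast
  ultimately have "v i = v j" using ij(4) by (auto dest: inj_onD)
  then show False using v ij by (auto dest: inj_onD)
qed

text \<open>Both sides consist of the transversal triples of a balanced partition into
  \<open>n - 1\<close> parts.\<close>

lemma optimal_iso_T3:
  assumes "optimal n V c" "finite V" "n \<ge> 7" "n \<le> Suc (card V)"
  obtains g where "bij_betw g V {..<card V}"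
    and "(\<lambda>e. g ` e) ` red_blue V c = edges (T3 (card V) (n - 1))"
proof -
  interpret optimal_coloring n V c using assms by unfold_locales
  let ?N = "card V" and ?k = "n - 1"
  let ?q = "\<lambda>x. x mod ?k"
  have k: "?k > 0" "?k \<le> ?N" using assms(3,4) by auto
  \<comment> \<open>Every residue occurs because \<open>?k \<le> ?N\<close>, so no part is
    empty.\<close>
  have q: "?q ` {..<?N} = {..<?k}"
  proof
    show "{..<?k} \<subseteq> ?q ` {..<?N}"
    proof
      fix r assume "r \<in> {..<?k}"
      then have "r = ?q r" "r \<in> {..<?N}" using k by auto
      then show "r \<in> ?q ` {..<?N}" by (rule image_eqI)
    qed
  qed (use k in auto)
  have "\<exists>g. bij_betw g V {..<?N} \<and> (\<forall>x\<in>V. \<forall>y\<in>V. ?q (g x) = ?q (g y) \<longleftrightarrow> cls x = cls y)"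
  proof (rule balanced_partitions_bij)
    show "card (cls ` V) = card (?q ` {..<?N})" unfolding q using card_classes by simp
    show "card {z \<in> V. cls z = i} \<le> Suc (card {z \<in> V. cls z = j})"
      if "i \<in> cls ` V" "j \<in> cls ` V" for i j
    proof -
      from that obtain x y where "x \<in> V" "i = cls x" "y \<in> V" "j = cls y" by blast
      then show ?thesis using balanced fibre_cls by simp
    qed
    show "card {z \<in> {..<?N}. ?q z = i} \<le> Suc (card {z \<in> {..<?N}. ?q z = j})"
      if "i \<in> ?q ` {..<?N}" "j \<in> ?q ` {..<?N}" for i j
    proof -
      have "{z \<in> {..<?N}. ?q z = r} = residue_part ?N ?k r" for r by (auto simp: residue_part_def)
      moreover have "i < ?k" "j < ?k" using that unfolding q by auto
      ultimately show ?thesis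
        using residue_part_card[of i ?k ?N] residue_part_card[of j ?k ?N] by auto
    qed
  qed (use fin in simp_all)
  then obtain g where g: "bij_betw g V {..<?N}"
    and gq: "\<And>x y. x \<in> V \<Longrightarrow> y \<in> V \<Longrightarrow> ?q (g x) = ?q (g y) \<longleftrightarrow> cls x = cls y" by blast
  have injg: "inj_on g V" and imgg: "g ` V = {..<?N}" using g by (auto simp: bij_betw_def)
  have *: "card (g ` e) = card e \<and> (inj_on ?q (g ` e) \<longleftrightarrow> inj_on cls e)" if "e \<subseteq> V" for e
  proof -
    have "inj_on g e" using injg that by (rule inj_on_subset)
    moreover have "inj_on (?q \<circ> g) e \<longleftrightarrow> inj_on cls e"
      using that gq by (auto simp: inj_on_def subset_iff)
    ultimately show ?thesis by (metis card_image comp_inj_on_iff)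
  qed
  have "(\<lambda>e. g ` e) ` red_blue V c = edges (T3 ?N ?k)"
  proof (intro equalityI subsetI)
    fix d assume "d \<in> (\<lambda>e. g ` e) ` red_blue V c"
    then obtain e where "d = g ` e" "e \<subseteq> V" "card e = 3" "inj_on cls e" by (auto simp: red_blue_eq)
    then show "d \<in> edges (T3 ?N ?k)"
      unfolding edges_T3[OF k(1)] using * imgg by auto
  next
    fix d assume d: "d \<in> edges (T3 ?N ?k)"
    then have "d \<subseteq> g ` V" unfolding edges_T3[OF k(1)] imgg by blast
    then obtain e where e: "e \<subseteq> V" "d = g ` e" by (auto simp: subset_image_iff)
    have "card d = 3" "inj_on ?q d" using d unfolding edges_T3[OF k(1)] by simp_all
    then have "e \<in> red_blue V c" using e *[OF e(1)] by (simp add: red_blue_eq)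
    then show "d \<in> (\<lambda>e. g ` e) ` red_blue V c" using e(2) by (rule rev_image_eqI)
  qed
  then show thesis using that g by blast
qed

lemma optimal_card:
  assumes opt: "optimal n V c" and fin: "finite V" and n: "n \<ge> 7" "n \<le> Suc (card V)"
  shows "card (red_blue V c) = t3 (card V) (n - 1)"
proof -
  obtain g where g: "bij_betw g V {..<card V}"
    "(\<lambda>e. g ` e) ` red_blue V c = edges (T3 (card V) (n - 1))"
    using optimal_iso_T3[OF assms] by blast
  have "inj_on g (\<Union>(red_blue V c))"
    using g(1) by (rule inj_on_subset[OF bij_betw_imp_inj_on]) (auto simp: red_blue_def)
  then show ?thesis using g(2) by (metis card_image inj_on_image t3_def)
qed

lemma card_red_blue_le:
  assumes "coloring c" "clique_free n V c" "finite V" "n \<ge> 7" "n \<le> Suc (card V)"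
  shows "card (red_blue V c) \<le> t3 (card V) (n - 1)"
proof -
  obtain c' where c': "optimal n V c'" using optimal_exists[of V n] assms by auto
  then have "card (red_blue V c) \<le> card (red_blue V c')" using assms by (simp add: optimal_def)
  then show ?thesis using optimal_card[OF c'] assms by simp
qed

section \<open>The bound and uniqueness for 3-graphs\<close>

lemma berge3_free_card_le:
  assumes "three_graph H" "family_free (berge3 n) H" "n \<ge> 7" "n \<le> Suc (card (verts H))"
  shows "card (edges H) \<le> t3 (card (verts H)) (n - 1)"
proof -
  obtain c where "coloring c" "clique_free n (verts H) c"
    "card (edges H) \<le> card (red_blue (verts H) c)"
    using red_blue_dominates[OF assms(1,2)] assms(3) by (metis le_trans one_le_numeral)
  moreover have "finite (verts H)" using assms(1) by (simp add: three_graph_def hypergraph_def)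
  ultimately show ?thesis using card_red_blue_le assms(3,4) le_trans by blast
qed

text \<open>Equality makes the associated colouring optimal, hence free of red pairs. Then the edges
  of \<open>H\<close> are blue triangles, and equal cardinality makes them all of the blue
  triangles.\<close>

lemma berge3_free_iso_T3:
  fixes H :: "'a hypergraph"
  assumes H: "three_graph H" "family_free (berge3 n) H" and bounds: "n \<ge> 7" "n \<le> Suc (card (verts H))"
    and card: "card (edges H) = t3 (card (verts H)) (n - 1)"
  shows "hyper_iso H (T3 (card (verts H)) (n - 1))"
proof -
  let ?V = "verts H"
  have fin: "finite ?V" using H(1) by (simp add: three_graph_def hypergraph_def)
  have "n \<ge> 1" using bounds by simp
  obtain c where c: "coloring c" "clique_free n ?V c"
    and le: "card (edges H) \<le> card (red_blue ?V c)"
    and sub: "(\<forall>x\<in>?V. \<forall>y\<in>?V. c x y \<noteq> Red) \<Longrightarrow> edges H \<subseteq> red_blue ?V c"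
    by (rule red_blue_dominates[OF H \<open>n \<ge> 1\<close>]) (rule that)
  have eq: "card (red_blue ?V c) = t3 (card ?V) (n - 1)"
    using le card card_red_blue_le[OF c fin bounds] by simp
  have opt: "optimal n ?V c"
    using c eq card_red_blue_le[OF _ _ fin bounds] by (simp add: optimal_def)
  interpret optimal_coloring n ?V c using opt fin bounds by unfold_locales
  have "edges H \<subseteq> red_blue ?V c" using no_red by (intro sub) blast
  then have "edges H = red_blue ?V c" using fin eq card by (intro card_subset_eq) auto
  moreover obtain g where "bij_betw g ?V {..<card ?V}"
    "(\<lambda>e. g ` e) ` red_blue ?V c = edges (T3 (card ?V) (n - 1))"
    using optimal_iso_T3[OF opt fin bounds] by blast
  moreover have "n - 1 > 0" using bounds by simp
  ultimately show ?thesis unfolding hyper_iso_def by (metis verts_T3)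
qed

theorem theorem1p1:
  fixes N n :: nat
  assumes "n \<ge> 13" and "N \<ge> n"
  shows "turan_number N (berge3 n) = t3 N (n - 1) \<and>
    extremal_berge3 N n (T3 N (n - 1)) \<and>
    (\<forall>H :: 'a hypergraph. extremal_berge3 N n H \<longrightarrow> hyper_iso H (T3 N (n - 1)))"
proof -
  let ?S = "{card (edges H) | H :: nat hypergraph.
    three_graph H \<and> card (verts H) = N \<and> family_free (berge3 n) H}"
  let ?T = "T3 N (n - 1)"
  have T: "three_graph ?T" "card (verts ?T) = N" "family_free (berge3 n) ?T"
    using assms by (auto intro!: T3_three_graph T3_family_free)
  have turan: "turan_number N (berge3 n) = t3 N (n - 1)"
    unfolding turan_number_def
  proof (rule Max_eqI)
    show "finite ?S" by (rule turan_set_finite)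
    show "m \<le> t3 N (n - 1)" if "m \<in> ?S" for m
    proof -
      from that obtain H :: "nat hypergraph" where "three_graph H" "card (verts H) = N"
        "family_free (berge3 n) H" "m = card (edges H)" by blast
      then show ?thesis using berge3_free_card_le[of H n] assms by simp
    qed
    \<comment> \<open>The lower bound: \<open>?T\<close> itself is an admissible 3-graph on the
      naturals.\<close>
    show "t3 N (n - 1) \<in> ?S" using T unfolding t3_def by blast
  qed
  moreover have "extremal_berge3 N n ?T"
    using T turan by (simp add: extremal_berge3_def t3_def)
  moreover have "hyper_iso H ?T" if "extremal_berge3 N n H" for H :: "'a hypergraph"
    using that berge3_free_iso_T3[of H n] turan assms by (auto simp: extremal_berge3_def)
  ultimately show ?thesis by blast
qed

end
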